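(* Let $G$ be a finite bipartite graph with color classes $A$ and $B$, and let $b:V(G)\to\mathbb{Z}_{\ge0}$. Then the binary relation $\le_A$ is a partial order on the set $\mathcal{F}$ of all $b$-flexible components of $G$.
   Context: A $b$-matching is $M\subseteq E(G)$ with at most $b(v)$ edges of $M$ at each vertex $v$; maximum = largest cardinality. An edge is allowed if it lies in some maximum $b$-matching, forbidden otherwise; an allowed edge is inevitable if it lies in every maximum $b$-matching, flexible otherwise. Flexible components are the induced subgraphs $G[V(K)]$ for $K$ a connected component of the spanning subgraph $(V(G),\{\text{flexible edges}\})$; $\mathcal{F}$ is their set. For $C_1,C_2\in\mathcal{F}$ write $C_1\preceq^\circ_A C_2$ if $C_1=C_2$, or there is an inevitable edge joining a vertex of $V(C_1)\cap A$ to a vertex of $V(C_2)\cap B$, or a forbidden edge joining a vertex of $V(C_2)\cap A$ to a vertex of $V(C_1)\cap B$. Then $C_1\le_A C_2$ means there exist $D_1,\dots,D_k\in\mathcal{F}$ ($k\ge1$) with $D_1=C_1$, $D_k=C_2$ and $D_i\preceq^\circ_A D_{i+1}$ for each $i<k$. *)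

theory Defs
  imports Main
begin

text \<open>
  Finite undirected graphs without loops. Parallel edges are permitted: an edge is a name,
  and \<open>ends G e\<close> is its set of two ends. A simple graph is the case where edges are
  two-element vertex sets and \<open>ends G\<close> is the identity.
\<close>

record ('v, 'e) graph =
  verts :: "'v set"
  edges :: "'e set"
  ends  :: "'e \<Rightarrow> 'v set"

definition finite_graph :: "('v, 'e) graph \<Rightarrow> bool" where
  "finite_graph G \<longleftrightarrow>
     finite (verts G) \<and> finite (edges G) \<and>
     (\<forall>e\<in>edges G. ends G e \<subseteq> verts G \<and> card (ends G e) = 2)"

definition bipartite :: "('v, 'e) graph \<Rightarrow> 'v set \<Rightarrow> 'v set \<Rightarrow> bool" where
  "bipartite G A B \<longleftrightarrow>
     A \<union> B = verts G \<and> A \<inter> B = {} \<and>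
     (\<forall>e\<in>edges G. \<exists>u\<in>A. \<exists>v\<in>B. ends G e = {u, v})"

definition induced_subgraph :: "('v, 'e) graph \<Rightarrow> 'v set \<Rightarrow> ('v, 'e) graph" where
  "induced_subgraph G X = G\<lparr>verts := X, edges := {e \<in> edges G. ends G e \<subseteq> X}\<rparr>"

definition spanning_subgraph :: "('v, 'e) graph \<Rightarrow> 'e set \<Rightarrow> ('v, 'e) graph" where
  "spanning_subgraph G F = G\<lparr>edges := F\<rparr>"

definition adjacency :: "('v, 'e) graph \<Rightarrow> ('v \<times> 'v) set" where
  "adjacency G = {(u, v). \<exists>e\<in>edges G. ends G e = {u, v}}"

definition connectivity :: "('v, 'e) graph \<Rightarrow> ('v \<times> 'v) set" where
  "connectivity G = {(u, v). u \<in> verts G \<and> v \<in> verts G \<and> (u, v) \<in> (adjacency G)\<^sup>*}"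

definition connected_components :: "('v, 'e) graph \<Rightarrow> ('v, 'e) graph set" where
  "connected_components G = induced_subgraph G ` (verts G // connectivity G)"

definition b_matching :: "('v, 'e) graph \<Rightarrow> ('v \<Rightarrow> nat) \<Rightarrow> 'e set \<Rightarrow> bool" where
  "b_matching G b M \<longleftrightarrow>
     M \<subseteq> edges G \<and> (\<forall>v\<in>verts G. card {e \<in> M. v \<in> ends G e} \<le> b v)"

definition maximum_b_matching :: "('v, 'e) graph \<Rightarrow> ('v \<Rightarrow> nat) \<Rightarrow> 'e set \<Rightarrow> bool" where
  "maximum_b_matching G b M \<longleftrightarrow>
     b_matching G b M \<and> (\<forall>N. b_matching G b N \<longrightarrow> card N \<le> card M)"

definition allowed_edges :: "('v, 'e) graph \<Rightarrow> ('v \<Rightarrow> nat) \<Rightarrow> 'e set" where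
  "allowed_edges G b = {e \<in> edges G. \<exists>M. maximum_b_matching G b M \<and> e \<in> M}"

definition forbidden_edges :: "('v, 'e) graph \<Rightarrow> ('v \<Rightarrow> nat) \<Rightarrow> 'e set" where
  "forbidden_edges G b = edges G - allowed_edges G b"

definition inevitable_edges :: "('v, 'e) graph \<Rightarrow> ('v \<Rightarrow> nat) \<Rightarrow> 'e set" where
  "inevitable_edges G b = {e \<in> allowed_edges G b. \<forall>M. maximum_b_matching G b M \<longrightarrow> e \<in> M}"

definition flexible_edges :: "('v, 'e) graph \<Rightarrow> ('v \<Rightarrow> nat) \<Rightarrow> 'e set" where
  "flexible_edges G b = allowed_edges G b - inevitable_edges G b"

definition flexible_components ::
    "('v, 'e) graph \<Rightarrow> ('v \<Rightarrow> nat) \<Rightarrow> ('v, 'e) graph set" where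
  "flexible_components G b =
     {induced_subgraph G (verts K) | K.
        K \<in> connected_components (spanning_subgraph G (flexible_edges G b))}"

text \<open>
  \<open>flex_step G b A B\<close> is \<open>\<preceq>\<^sup>\<circ>\<^sub>A\<close>, and
  \<open>flex_le G b A B\<close> is \<open>\<le>\<^sub>A\<close>.
\<close>

definition flex_step ::
    "('v, 'e) graph \<Rightarrow> ('v \<Rightarrow> nat) \<Rightarrow> 'v set \<Rightarrow> 'v set \<Rightarrow>
     ('v, 'e) graph \<Rightarrow> ('v, 'e) graph \<Rightarrow> bool" where
  "flex_step G b A B C1 C2 \<longleftrightarrow>
     C1 = C2 \<or>
     (\<exists>e\<in>inevitable_edges G b. \<exists>u\<in>verts C1 \<inter> A. \<exists>v\<in>verts C2 \<inter> B. ends G e = {u, v}) \<or>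
     (\<exists>e\<in>forbidden_edges G b. \<exists>u\<in>verts C2 \<inter> A. \<exists>v\<in>verts C1 \<inter> B. ends G e = {u, v})"

definition flex_le ::
    "('v, 'e) graph \<Rightarrow> ('v \<Rightarrow> nat) \<Rightarrow> 'v set \<Rightarrow> 'v set \<Rightarrow>
     ('v, 'e) graph \<Rightarrow> ('v, 'e) graph \<Rightarrow> bool" where
  "flex_le G b A B C1 C2 \<longleftrightarrow>
     (\<exists>Ds. Ds \<noteq> [] \<and> set Ds \<subseteq> flexible_components G b \<and> hd Ds = C1 \<and> last Ds = C2 \<and>
        (\<forall>i. Suc i < length Ds \<longrightarrow> flex_step G b A B (Ds ! i) (Ds ! Suc i)))"

end

theory Submission
  imports Defs
begin

text \<open>
  Fix a maximum \<open>b\<close>-matching \<open>M\<close> and orient the edges of \<open>M\<close> from \<open>A\<close> to \<open>B\<close> and all other edges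
  from \<open>B\<close> to \<open>A\<close>. A source, joined to \<open>A\<close>, and a sink, joined to \<open>B\<close>, keep track of the slack in
  the degree constraints, which yields the residual digraph of a maximum flow. An edge is flexible
  if and only if its arc lies on a directed closed walk: the arc set of a closed walk contains a
  balanced arc set through the given arc, and flipping that yields another maximum
  \<open>b\<close>-matching; conversely, if the arc enters a set closed under reachability, counting the edges
  across the cut shows that every maximum \<open>b\<close>-matching agrees with \<open>M\<close> on it. Hence flexible
  components are strongly connected in the residual digraph, while a step of the order between
  distinct components is a residual arc that is not flexible, so that no cycle of components can
  contain it.
\<close>

subsection \<open>Balanced arc sets in digraphs\<close>

definition arc_rel :: "('f \<Rightarrow> 'n) \<Rightarrow> ('f \<Rightarrow> 'n) \<Rightarrow> 'f set \<Rightarrow> ('n \<times> 'n) set" where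
  "arc_rel t h F = (\<lambda>f. (t f, h f)) ` F"

definition net_out :: "('f \<Rightarrow> 'n) \<Rightarrow> ('f \<Rightarrow> 'n) \<Rightarrow> 'f set \<Rightarrow> 'n \<Rightarrow> int" where
  "net_out t h P v = (\<Sum>f\<in>P. of_bool (t f = v) - of_bool (h f = v))"

lemma reach_from_head_avoiding_arc:
  assumes "(h f, w) \<in> (arc_rel t h F)\<^sup>*"
  shows "(h f, w) \<in> (arc_rel t h (F - {f}))\<^sup>*"
  using assms
proof (induction rule: rtrancl_induct)
  case (step y z)
  then obtain g where g: "g \<in> F" "y = t g" "z = h g"
    by (auto simp: arc_rel_def)
  show ?case
  proof (cases "g = f")
    case False
    then have "(y, z) \<in> arc_rel t h (F - {f})"
      using g by (auto simp: arc_rel_def)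
    with step.IH show ?thesis by simp
  qed (use g in simp)
qed simp

text \<open>Each arc is deleted from \<open>F\<close> once it has been traversed. The walk therefore
  repeats no arc, and the net outflows of its arc set telescope to its two ends.\<close>

lemma ex_path_arcs:
  assumes "finite F" "(u, w) \<in> (arc_rel t h F)\<^sup>*"
  shows "\<exists>P\<subseteq>F. \<forall>v. net_out t h P v = of_bool (u = v) - of_bool (w = v)"
  using assms
proof (induction F arbitrary: u rule: finite_psubset_induct)
  case (psubset F)
  from psubset.prems show ?case
  proof (cases rule: converse_rtranclE)
    case base
    then show ?thesis by (intro exI[of _ "{}"]) (auto simp: net_out_def)
  next
    case (step x)
    then obtain f where f: "f \<in> F" "u = t f" "x = h f"
      by (auto simp: arc_rel_def)
    then have "(h f, w) \<in> (arc_rel t h (F - {f}))\<^sup>*"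
      using step reach_from_head_avoiding_arc by metis
    with psubset.IH[of "F - {f}" "h f"] f(1) obtain P
      where P: "P \<subseteq> F - {f}"
        "\<And>v. net_out t h P v = of_bool (h f = v) - of_bool (w = v)"
      by blast
    moreover have "finite P" "f \<notin> P"
      using P(1) psubset.hyps finite_subset by blast+
    ultimately show ?thesis
      using f by (intro exI[of _ "insert f P"]) (auto simp: net_out_def)
  qed
qed

text \<open>The arc \<open>f\<close> closes a trail from \<open>h f\<close> to \<open>t f\<close>
  that avoids \<open>f\<close>, so \<open>f\<close> is counted exactly once.\<close>

lemma ex_balanced_arcs_through:
  assumes "finite F" "f \<in> F" "(h f, t f) \<in> (arc_rel t h F)\<^sup>*"
  obtains P where "P \<subseteq> F" "f \<in> P" "\<And>v. net_out t h P v = 0"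
proof -
  obtain P where P: "P \<subseteq> F - {f}"
    "\<And>v. net_out t h P v = of_bool (h f = v) - of_bool (t f = v)"
    using ex_path_arcs[OF _ reach_from_head_avoiding_arc[OF assms(3)]] assms(1)
    by (metis finite_Diff)
  have "finite P" "f \<notin> P"
    using P(1) assms(1) finite_subset by blast+
  then have "net_out t h (insert f P) v = 0" for v
    using P(2)[of v] by (simp add: net_out_def)
  then show ?thesis
    using P(1) assms(2) by (intro that[of "insert f P"]) auto
qed

subsection \<open>The residual digraph\<close>

datatype 'v node = Vertex 'v | Source | Sink

text \<open>
  \<open>Leave v\<close> runs from \<open>v\<close> to its terminal (the source for \<open>v \<in> A\<close>, the sink for \<open>v \<in> B\<close>) and
  \<open>Enter v\<close> runs back. Flipping a flow through \<open>v\<close> along \<open>Leave v\<close> raises the degree of \<open>v\<close> if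
  \<open>v \<in> A\<close> but lowers it if \<open>v \<in> B\<close>, so only one of the two arcs requires slack at \<open>v\<close>.
\<close>

datatype ('v, 'e) arc = Edge 'e | Leave 'v | Enter 'v

locale bipartite_b_graph =
  fixes G :: "('v, 'e) graph" and A B :: "'v set" and b :: "'v \<Rightarrow> nat"
  assumes fin: "finite_graph G" and bip: "bipartite G A B"
begin

definition a_end :: "'e \<Rightarrow> 'v" where
  "a_end e = (THE u. u \<in> A \<and> u \<in> ends G e)"

definition b_end :: "'e \<Rightarrow> 'v" where
  "b_end e = (THE v. v \<in> B \<and> v \<in> ends G e)"

definition deg :: "'e set \<Rightarrow> 'v \<Rightarrow> nat" where
  "deg M v = card {e \<in> M. v \<in> ends G e}"

fun terminal :: "'v \<Rightarrow> 'v node" where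
  "terminal v = (if v \<in> A then Source else Sink)"

fun tail :: "'e set \<Rightarrow> ('v, 'e) arc \<Rightarrow> 'v node" where
  "tail M (Edge e) = Vertex (if e \<in> M then a_end e else b_end e)"
| "tail M (Leave v) = Vertex v"
| "tail M (Enter v) = terminal v"

fun head :: "'e set \<Rightarrow> ('v, 'e) arc \<Rightarrow> 'v node" where
  "head M (Edge e) = Vertex (if e \<in> M then b_end e else a_end e)"
| "head M (Leave v) = terminal v"
| "head M (Enter v) = Vertex v"

definition residual :: "'e set \<Rightarrow> ('v, 'e) arc set" where
  "residual M = Edge ` edges G \<union> Leave ` ({v \<in> A. deg M v < b v} \<union> B)
     \<union> Enter ` (A \<union> {v \<in> B. deg M v < b v})"

definition reach :: "'e set \<Rightarrow> ('v node \<times> 'v node) set" where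
  "reach M = (arc_rel (tail M) (head M) (residual M))\<^sup>*"

lemma finite_sets: "finite A" "finite B" "finite (edges G)"
  using fin bip by (auto simp: finite_graph_def bipartite_def intro: finite_subset)

lemma disjoint: "v \<in> A \<Longrightarrow> v \<notin> B" "v \<in> B \<Longrightarrow> v \<notin> A"
  using bip by (auto simp: bipartite_def)

lemma ends_eqD:
  assumes "ends G e = {u, v}" "u \<in> A" "v \<in> B"
  shows "a_end e = u" "b_end e = v"
  using assms disjoint by (auto simp: a_end_def b_end_def intro!: the_equality)

lemma edge_ends:
  assumes "e \<in> edges G"
  shows "a_end e \<in> A" "b_end e \<in> B" "ends G e = {a_end e, b_end e}"
proof -
  obtain u v where "u \<in> A" "v \<in> B" "ends G e = {u, v}"
    using bip assms unfolding bipartite_def by blast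
  then show "a_end e \<in> A" "b_end e \<in> B" "ends G e = {a_end e, b_end e}"
    using ends_eqD by auto
qed

lemma finite_residual: "finite (residual M)"
  using finite_sets by (simp add: residual_def)

section \<open>Degrees as sums over edges, and maximum b-matchings\<close>

lemma deg_eq_sum:
  assumes "M \<subseteq> edges G" "end = a_end \<and> v \<in> A \<or> end = b_end \<and> v \<in> B"
  shows "int (deg M v) = (\<Sum>e\<in>edges G. of_bool (e \<in> M) * of_bool (end e = v))"
proof -
  have "{e \<in> M. v \<in> ends G e} = {e \<in> edges G. e \<in> M \<and> end e = v}"
    using assms edge_ends disjoint by fastforce
  moreover have "int (card {e \<in> edges G. e \<in> M \<and> end e = v})
      = (\<Sum>e\<in>edges G. of_bool (e \<in> M \<and> end e = v))"
    using finite_sets(3) by (simp add: of_bool_def sum.If_cases Int_def)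
  ultimately show ?thesis
    by (simp add: deg_def of_bool_conj)
qed

text \<open>Double counting: every edge has exactly one end on each side, so a set \<open>X\<close>
  within one side meets it at most once.\<close>

lemma sum_deg_diff:
  assumes "M \<subseteq> edges G" "N \<subseteq> edges G"
    and "end = a_end \<and> X \<subseteq> A \<or> end = b_end \<and> X \<subseteq> B"
  shows "(\<Sum>v\<in>X. int (deg N v) - int (deg M v))
    = (\<Sum>e\<in>edges G. (of_bool (e \<in> N) - of_bool (e \<in> M)) * of_bool (end e \<in> X))"
proof -
  have X: "finite X"
    using assms(3) finite_sets finite_subset by blast
  have "(\<Sum>v\<in>X. int (deg N v) - int (deg M v))
      = (\<Sum>v\<in>X. \<Sum>e\<in>edges G. (of_bool (e \<in> N) - of_bool (e \<in> M)) * of_bool (end e = v))"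
  proof (rule sum.cong[OF refl])
    fix v assume "v \<in> X"
    then have "end = a_end \<and> v \<in> A \<or> end = b_end \<and> v \<in> B"
      using assms(3) by blast
    from deg_eq_sum[OF assms(1) this] deg_eq_sum[OF assms(2) this]
    show "int (deg N v) - int (deg M v)
        = (\<Sum>e\<in>edges G. (of_bool (e \<in> N) - of_bool (e \<in> M)) * of_bool (end e = v))"
      by (simp add: sum_subtractf left_diff_distrib)
  qed
  also have "\<dots> = (\<Sum>e\<in>edges G. (of_bool (e \<in> N) - of_bool (e \<in> M)) * (\<Sum>v\<in>X. of_bool (end e = v)))"
    by (subst sum.swap) (simp add: sum_distrib_left)
  also have "\<dots> = (\<Sum>e\<in>edges G. (of_bool (e \<in> N) - of_bool (e \<in> M)) * of_bool (end e \<in> X))"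
    using X by (simp add: of_bool_def sum.delta)
  finally show ?thesis .
qed

lemma sum_deg_diff_side:
  assumes "M \<subseteq> edges G" "N \<subseteq> edges G" "X = A \<or> X = B"
  shows "(\<Sum>v\<in>X. int (deg N v) - int (deg M v)) = int (card N) - int (card M)"
proof -
  define end' where "end' = (if X = A then a_end else b_end)"
  have card_eq: "int (card L) = (\<Sum>e\<in>edges G. of_bool (e \<in> L))" if "L \<subseteq> edges G" for L
    using that finite_sets(3) by (simp add: of_bool_def sum.If_cases Int_absorb1)
  have "(\<Sum>v\<in>X. int (deg N v) - int (deg M v))
      = (\<Sum>e\<in>edges G. (of_bool (e \<in> N) - of_bool (e \<in> M)) * of_bool (end' e \<in> X))"
    using assms by (intro sum_deg_diff) (auto simp: end'_def)
  also have "\<dots> = (\<Sum>e\<in>edges G. of_bool (e \<in> N) - of_bool (e \<in> M))"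
    using assms(3) edge_ends by (intro sum.cong) (auto simp: end'_def)
  finally show ?thesis
    using assms(1,2) by (simp add: sum_subtractf card_eq)
qed

lemma b_matching_iff:
  "b_matching G b M \<longleftrightarrow> M \<subseteq> edges G \<and> (\<forall>v\<in>A \<union> B. deg M v \<le> b v)"
  using bip by (simp add: b_matching_def deg_def bipartite_def)

lemma maximum_b_matchingD:
  assumes "maximum_b_matching G b M"
  shows "M \<subseteq> edges G" "v \<in> A \<union> B \<Longrightarrow> deg M v \<le> b v"
  using assms by (auto simp: maximum_b_matching_def b_matching_iff)

lemma card_maximum_b_matching:
  assumes "maximum_b_matching G b M" "maximum_b_matching G b N"
  shows "card N = card M"
  using assms by (simp add: maximum_b_matching_def order_antisym)

lemma ex_maximum_b_matching: "\<exists>M. maximum_b_matching G b M"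
proof -
  have "b_matching G b {}"
    by (simp add: b_matching_def)
  moreover have "\<forall>N. b_matching G b N \<longrightarrow> card N < Suc (card (edges G))"
    using finite_sets(3) by (auto simp: b_matching_def less_Suc_eq_le intro: card_mono)
  ultimately show ?thesis
    using ex_has_greatest_nat[of "b_matching G b" "{}" card "Suc (card (edges G))"]
    by (auto simp: maximum_b_matching_def)
qed

text \<open>Splitting \<open>P\<close> by arc constructor separates the edges, which change the
  degrees, from the terminal arcs, which record the slack used.\<close>

lemma net_out_residual:
  fixes P :: "('v, 'e) arc set"
  assumes "finite P"
  shows "net_out (tail M) (head M) P n
    = (\<Sum>e | Edge e \<in> P. of_bool (tail M (Edge e) = n) - of_bool (head M (Edge e) = n))
      + (\<Sum>v | Leave v \<in> P. of_bool (Vertex v = n) - of_bool (terminal v = n))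
      + (\<Sum>v | Enter v \<in> P. of_bool (terminal v = n) - of_bool (Vertex v = n))"
proof -
  let ?X = "{e. Edge e \<in> P}" and ?Y = "{v. Leave v \<in> P}" and ?Z = "{v. Enter v \<in> P}"
  have P: "P = Edge ` ?X \<union> (Leave ` ?Y \<union> Enter ` ?Z)"
  proof (rule set_eqI)
    show "f \<in> P \<longleftrightarrow> f \<in> Edge ` ?X \<union> (Leave ` ?Y \<union> Enter ` ?Z)" for f
      by (cases f) auto
  qed
  have fins: "finite (Edge ` ?X :: ('v, 'e) arc set)" "finite (Leave ` ?Y :: ('v, 'e) arc set)"
    "finite (Enter ` ?Z :: ('v, 'e) arc set)"
    by (rule finite_subset[OF _ assms]; blast)+
  show ?thesis
    unfolding net_out_def
    apply (subst P)
    apply (subst sum.union_disjoint)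
    using fins apply auto[3]
    apply (subst sum.union_disjoint)
    using fins apply auto[3]
    by (simp add: sum.reindex inj_on_def del: terminal.simps)
qed

subsection \<open>Flexible edges and reachability\<close>

lemma flexible_edges_iff:
  "e \<in> flexible_edges G b \<longleftrightarrow> e \<in> edges G \<and>
    (\<exists>M N. maximum_b_matching G b M \<and> maximum_b_matching G b N \<and> e \<in> M \<and> e \<notin> N)"
  by (auto simp: flexible_edges_def allowed_edges_def inevitable_edges_def)

text \<open>Flipping the edges of a balanced arc set through \<open>e\<close> gives
  \<open>N\<close>. Balance at the vertices keeps \<open>N\<close> within the bounds
  \<open>b\<close>; balance at the source preserves cardinality.\<close>

lemma flexible_if_head_reaches_tail:
  assumes M: "maximum_b_matching G b M" and e: "e \<in> edges G"
    and cyc: "(head M (Edge e), tail M (Edge e)) \<in> reach M"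
  shows "e \<in> flexible_edges G b"
proof -
  have "Edge e \<in> residual M"
    using e by (simp add: residual_def)
  from ex_balanced_arcs_through[OF finite_residual this cyc[unfolded reach_def]]
  obtain P where P: "P \<subseteq> residual M" "Edge e \<in> P"
    and bal: "\<And>n. net_out (tail M) (head M) P n = 0"
    by metis
  have finP: "finite P"
    using P(1) finite_residual finite_subset by blast
  define N where "N = {f \<in> edges G. (f \<in> M) \<noteq> (Edge f \<in> P)}"
  have sub: "M \<subseteq> edges G" "N \<subseteq> edges G"
    using maximum_b_matchingD(1)[OF M] by (auto simp: N_def)
  have P_edges: "{f. Edge f \<in> P} \<subseteq> edges G"
    and P_leave: "{v. Leave v \<in> P} \<subseteq> {v \<in> A. deg M v < b v} \<union> B"
    and P_enter: "{v. Enter v \<in> P} \<subseteq> A \<union> {v \<in> B. deg M v < b v}"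
    using P(1) by (auto simp: residual_def)
  have fins: "finite {v. Leave v \<in> P}" "finite {v. Enter v \<in> P}"
    using P_leave P_enter finite_sets by (auto intro: finite_subset[of _ "A \<union> B"])
  have deg_diff: "int (deg N v) - int (deg M v)
      = (\<Sum>f | Edge f \<in> P. (if f \<in> M then - 1 else 1) * of_bool (end f = v))"
    if "end = a_end \<and> v \<in> A \<or> end = b_end \<and> v \<in> B" for "end" v
  proof -
    have "int (deg N v) - int (deg M v)
        = (\<Sum>f\<in>edges G. (of_bool (f \<in> N) - of_bool (f \<in> M)) * of_bool (end f = v))"
      using deg_eq_sum[OF sub(1) that] deg_eq_sum[OF sub(2) that]
      by (simp add: sum_subtractf left_diff_distrib)
    also have "\<dots> = (\<Sum>f | Edge f \<in> P. (of_bool (f \<in> N) - of_bool (f \<in> M)) * of_bool (end f = v))"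
      using P_edges by (intro sum.mono_neutral_right finite_sets) (auto simp: N_def)
    also have "\<dots> = (\<Sum>f | Edge f \<in> P. (if f \<in> M then - 1 else 1) * of_bool (end f = v))"
      using P_edges by (intro sum.cong) (auto simp: N_def)
    finally show ?thesis .
  qed
  \<comment> \<open>Balance at \<open>v\<close>: the net outflow along edge arcs is offset by the
    terminal arcs at \<open>v\<close>.\<close>
  have net_vertex: "(\<Sum>f | Edge f \<in> P. of_bool (tail M (Edge f) = Vertex v) - of_bool (head M (Edge f) = Vertex v))
      = of_bool (Enter v \<in> P) - (of_bool (Leave v \<in> P) :: int)" for v
  proof -
    have "(\<Sum>u | Leave u \<in> P. of_bool (Vertex u = Vertex v) - of_bool (terminal u = Vertex v))
        = (\<Sum>u | Leave u \<in> P. if u = v then 1 else 0 :: int)"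
      by (intro sum.cong) auto
    also have "\<dots> = of_bool (Leave v \<in> P)"
      using fins(1) by simp
    finally have "(\<Sum>u | Leave u \<in> P. of_bool (Vertex u = Vertex v) - of_bool (terminal u = Vertex v))
        = (of_bool (Leave v \<in> P) :: int)" .
    moreover have "(\<Sum>u | Enter u \<in> P. of_bool (terminal u = Vertex v) - of_bool (Vertex u = Vertex v))
        = (\<Sum>u | Enter u \<in> P. if u = v then - 1 else 0 :: int)"
      by (intro sum.cong) auto
    then have "(\<Sum>u | Enter u \<in> P. of_bool (terminal u = Vertex v) - of_bool (Vertex u = Vertex v))
        = - (of_bool (Enter v \<in> P) :: int)"
      using fins(2) by simp
    ultimately show ?thesis
      using bal[of "Vertex v"] unfolding net_out_residual[OF finP] by linarith
  qed
  \<comment> \<open>At \<open>v\<close> in \<open>A\<close>, outgoing edge arcs are the edges of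
    \<open>M\<close>, which flipping removes, so the degree changes by minus the net outflow. At
    \<open>B\<close> the sign is reversed.\<close>
  have diff_A: "int (deg N v) - int (deg M v) = of_bool (Leave v \<in> P) - of_bool (Enter v \<in> P)"
    if "v \<in> A" for v
  proof -
    have "(\<Sum>f | Edge f \<in> P. (if f \<in> M then - 1 else 1) * of_bool (a_end f = v))
      = - (\<Sum>f | Edge f \<in> P. of_bool (tail M (Edge f) = Vertex v) - (of_bool (head M (Edge f) = Vertex v) :: int))"
      unfolding sum_negf[symmetric]
      using that P_edges edge_ends(1,2) disjoint by (intro sum.cong) fastforce+
    then show ?thesis
      using deg_diff[of a_end v] net_vertex[of v] that by simp
  qed
  have diff_B: "int (deg N v) - int (deg M v) = of_bool (Enter v \<in> P) - of_bool (Leave v \<in> P)"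
    if "v \<in> B" for v
  proof -
    have "(\<Sum>f | Edge f \<in> P. (if f \<in> M then - 1 else 1) * of_bool (b_end f = v))
      = (\<Sum>f | Edge f \<in> P. of_bool (tail M (Edge f) = Vertex v) - (of_bool (head M (Edge f) = Vertex v) :: int))"
      using that P_edges edge_ends(1,2) disjoint by (intro sum.cong) fastforce+
    then show ?thesis
      using deg_diff[of b_end v] net_vertex[of v] that by simp
  qed
  \<comment> \<open>The degree rises by at most 1, and only through a terminal arc that is residual
    only if \<open>M\<close> has slack at \<open>v\<close>.\<close>
  have "deg N v \<le> b v" if "v \<in> A \<union> B" for v
  proof (cases "v \<in> A")
    case True
    then show ?thesis
      using diff_A[OF True] maximum_b_matchingD(2)[OF M that] P_leave disjoint(1)[OF True]
      by (cases "Leave v \<in> P"; cases "Enter v \<in> P") auto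
  next
    case False
    then show ?thesis
      using diff_B[of v] maximum_b_matchingD(2)[OF M that] P_enter that
      by (cases "Leave v \<in> P"; cases "Enter v \<in> P") auto
  qed
  then have "b_matching G b N"
    using sub by (simp add: b_matching_iff)
  moreover have "card N = card M"
  proof -
    \<comment> \<open>Summed over \<open>A\<close>, the degree changes count the terminal arcs of
      \<open>P\<close> into \<open>Source\<close> minus those out of it.\<close>
    have "int (card N) - int (card M) = (\<Sum>v\<in>A. of_bool (Leave v \<in> P) - of_bool (Enter v \<in> P))"
      using sum_deg_diff_side[OF sub, of A] diff_A by simp
    also have "\<dots> = int (card (A \<inter> {v. Leave v \<in> P})) - int (card (A \<inter> {v. Enter v \<in> P}))"
      using finite_sets(1) by (simp add: sum_subtractf)
    also have "\<dots> = - net_out (tail M) (head M) P Source"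
    proof -
      have "(\<Sum>u | Leave u \<in> P. of_bool (Vertex u = Source) - of_bool (terminal u = Source))
          = (\<Sum>u | Leave u \<in> P. - of_bool (u \<in> A) :: int)"
        by (intro sum.cong) auto
      moreover have "(\<Sum>u | Enter u \<in> P. of_bool (terminal u = Source) - of_bool (Vertex u = Source))
          = (\<Sum>u | Enter u \<in> P. of_bool (u \<in> A) :: int)"
        by (intro sum.cong) auto
      ultimately show ?thesis
        unfolding net_out_residual[OF finP] using fins by (simp add: sum_negf Int_commute)
    qed
    finally show ?thesis
      using bal by simp
  qed
  ultimately have "maximum_b_matching G b N"
    using M by (simp add: maximum_b_matching_def)
  moreover have "(e \<in> N) \<noteq> (e \<in> M)"
    using e P(2) by (simp add: N_def)
  ultimately show ?thesis
    using M e by (auto simp: flexible_edges_iff)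
qed

text \<open>Otherwise the arc of \<open>e\<close> enters the set \<open>S\<close> of nodes reachable
  from its head, which no residual arc leaves. Counting the change from \<open>M\<close> to
  \<open>N\<close> across this cut gives a contradiction.\<close>

lemma head_reaches_tail_if_flexible:
  assumes M: "maximum_b_matching G b M" and flex: "e \<in> flexible_edges G b"
  shows "(head M (Edge e), tail M (Edge e)) \<in> reach M"
proof (rule ccontr)
  assume contra: "\<not> ?thesis"
  obtain N where N: "maximum_b_matching G b N" "(e \<in> N) \<noteq> (e \<in> M)"
    using flex by (auto simp: flexible_edges_iff)
  have e: "e \<in> edges G"
    using flex by (simp add: flexible_edges_iff)
  note sub = maximum_b_matchingD(1)[OF M] maximum_b_matchingD(1)[OF N(1)]
  define S where "S = reach M `` {head M (Edge e)}"
  define T where "T = {v. Vertex v \<in> S}"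
  have closed: "head M f \<in> S" if "f \<in> residual M" "tail M f \<in> S" for f
  proof -
    have "(tail M f, head M f) \<in> arc_rel (tail M) (head M) (residual M)"
      using that(1) by (auto simp: arc_rel_def)
    then show ?thesis
      using that(2) unfolding S_def reach_def by (auto intro: rtrancl_into_rtrancl)
  qed
  have e_enters: "head M (Edge e) \<in> S" "tail M (Edge e) \<notin> S"
    using contra by (auto simp: S_def reach_def)
  let ?d = "\<lambda>v. int (deg N v) - int (deg M v)"
  have sides: "sum ?d A = 0" "sum ?d B = 0"
    using sum_deg_diff_side[OF sub] card_maximum_b_matching[OF M N(1)] by auto
  have d_le: "?d v \<le> 0" if "v \<in> A \<union> B" "\<not> deg M v < b v" for v
    using that maximum_b_matchingD(2)[OF N(1) that(1)] by simp
  \<comment> \<open>If \<open>Source\<close> is in \<open>S\<close>, then \<open>T\<close> contains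
    all of \<open>A\<close>, where the changes sum to 0. Otherwise \<open>M\<close> saturates every
    vertex of \<open>A \<inter> T\<close>, so no degree there can rise.\<close>
  have le_A: "sum ?d (A \<inter> T) \<le> 0"
  proof (cases "Source \<in> S")
    case True
    have "A \<subseteq> T"
      using closed[of "Enter _"] True by (auto simp: T_def residual_def)
    then show ?thesis
      using sides by (simp add: Int_absorb2)
  next
    case False
    have "\<not> deg M v < b v" if "v \<in> A \<inter> T" for v
      using closed[of "Leave v"] False that by (auto simp: T_def residual_def)
    then show ?thesis
      using d_le by (intro sum_nonpos) blast
  qed
  \<comment> \<open>A vertex of \<open>B\<close> in \<open>T\<close> puts \<open>Sink\<close> into
    \<open>S\<close>. Then \<open>M\<close> saturates \<open>B - T\<close>, so the sum there is at
    most 0 and its complement in \<open>B\<close> is at least 0.\<close>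
  have ge_B: "sum ?d (B \<inter> T) \<ge> 0"
  proof (cases "B \<inter> T = {}")
    case False
    then obtain w where "w \<in> B" "w \<in> T" by blast
    then have sink: "Sink \<in> S"
      using closed[of "Leave w"] disjoint by (auto simp: T_def residual_def)
    have "\<not> deg M v < b v" if "v \<in> B - T" for v
      using closed[of "Enter v"] disjoint sink that by (auto simp: T_def residual_def)
    then have "sum ?d (B - T) \<le> 0"
      using d_le by (intro sum_nonpos) blast
    moreover have "sum ?d B = sum ?d (B - T) + sum ?d (B \<inter> T)"
      using sum.Int_Diff[OF finite_sets(2), of ?d T] by simp
    ultimately show ?thesis
      using sides by linarith
  qed simp
  \<comment> \<open>Only crossing edges contribute, and their arcs all enter \<open>S\<close>. Those
    in \<open>M\<close> have weight -1 and can only be lost; the others have weight 1 and can only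
    be gained. At \<open>e\<close> the change does occur.\<close>
  let ?c = "\<lambda>f. (of_bool (f \<in> N) - of_bool (f \<in> M)) * (of_bool (a_end f \<in> T) - of_bool (b_end f \<in> T)) :: int"
  have "sum ?d (A \<inter> T) - sum ?d (B \<inter> T) = sum ?c (edges G)"
    using sum_deg_diff[OF sub, of a_end "A \<inter> T"] sum_deg_diff[OF sub, of b_end "B \<inter> T"] edge_ends
    by (simp add: sum_subtractf[symmetric] right_diff_distrib)
  moreover have "sum ?c (edges G) > 0"
  proof (rule sum_pos2[OF finite_sets(3) e])
    show "?c e > 0"
      using e_enters N(2) by (auto simp: T_def split: if_splits)
    show "?c f \<ge> 0" if "f \<in> edges G" for f
      using closed[of "Edge f"] that by (cases "f \<in> M") (auto simp: T_def residual_def)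
  qed
  ultimately show False using le_A ge_B by linarith
qed

subsection \<open>Flexible components\<close>

lemma reach_edge: "e \<in> edges G \<Longrightarrow> (tail M (Edge e), head M (Edge e)) \<in> reach M"
  unfolding reach_def arc_rel_def residual_def by (intro r_into_rtrancl imageI) blast

lemma reach_trans: "(x, y) \<in> reach M \<Longrightarrow> (y, z) \<in> reach M \<Longrightarrow> (x, z) \<in> reach M"
  by (simp add: reach_def)

text \<open>One direction is the arc of \<open>e\<close>, the other its return walk.\<close>

lemma flexible_edge_reach:
  assumes "maximum_b_matching G b M" "e \<in> flexible_edges G b" "ends G e = {u, v}"
  shows "(Vertex u, Vertex v) \<in> reach M"
proof -
  have e: "e \<in> edges G"
    using assms(2) by (simp add: flexible_edges_iff)
  have "(u = a_end e \<and> v = b_end e) \<or> (u = b_end e \<and> v = a_end e)"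
    using edge_ends(3)[OF e] assms(3) by (auto simp: doubleton_eq_iff)
  then show ?thesis
    using reach_edge[OF e, of M] head_reaches_tail_if_flexible[OF assms(1,2)]
    by (auto split: if_splits)
qed

lemma flexible_component_reach:
  assumes M: "maximum_b_matching G b M" and C: "C \<in> flexible_components G b"
    and uv: "u \<in> verts C" "v \<in> verts C"
  shows "(Vertex u, Vertex v) \<in> reach M"
proof -
  let ?H = "spanning_subgraph G (flexible_edges G b)"
  \<comment> \<open>Both directions are needed, since two vertices of a class are joined through a
    representative \<open>w\<close>.\<close>
  have adj: "(Vertex x, Vertex y) \<in> reach M \<and> (Vertex y, Vertex x) \<in> reach M"
    if "(x, y) \<in> (adjacency ?H)\<^sup>*" for x y
    using that
  proof (induction rule: rtrancl_induct)
    case base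
    then show ?case by (simp add: reach_def)
  next
    case (step y z)
    then obtain f where "f \<in> flexible_edges G b" "ends G f = {y, z}"
      by (auto simp: adjacency_def spanning_subgraph_def)
    then have "(Vertex y, Vertex z) \<in> reach M" "(Vertex z, Vertex y) \<in> reach M"
      using flexible_edge_reach[OF M] by (auto simp: insert_commute)
    then show ?case
      using step.IH by (auto intro: reach_trans)
  qed
  obtain w where "(w, u) \<in> (adjacency ?H)\<^sup>*" "(w, v) \<in> (adjacency ?H)\<^sup>*"
    using C uv
    by (auto simp: flexible_components_def connected_components_def induced_subgraph_def
        quotient_def connectivity_def)
  then show ?thesis
    using adj reach_trans by blast
qed

text \<open>Inevitable edges lie in \<open>M\<close> and point from \<open>A\<close> to
  \<open>B\<close>; forbidden edges avoid \<open>M\<close> and point from \<open>B\<close> to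
  \<open>A\<close>. Both kinds of step thus follow a residual arc from \<open>C\<close> to
  \<open>D\<close>.\<close>

lemma flex_step_cases:
  assumes M: "maximum_b_matching G b M" and step: "flex_step G b A B C D"
  obtains "C = D"
  | e x y where "e \<in> edges G" "e \<notin> flexible_edges G b"
      "tail M (Edge e) = Vertex x" "x \<in> verts C" "head M (Edge e) = Vertex y" "y \<in> verts D"
proof -
  consider "C = D"
    | e u v where "e \<in> inevitable_edges G b" "u \<in> verts C" "u \<in> A" "v \<in> verts D" "v \<in> B"
        "ends G e = {u, v}"
    | e u v where "e \<in> forbidden_edges G b" "u \<in> verts D" "u \<in> A" "v \<in> verts C" "v \<in> B"
        "ends G e = {u, v}"
    using step unfolding flex_step_def by blast
  then show ?thesis
  proof cases
    case 1
    then show ?thesis by (rule that(1))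
  next
    case (2 e u v)
    then have "e \<in> edges G" "e \<notin> flexible_edges G b" "e \<in> M"
      using M by (auto simp: inevitable_edges_def allowed_edges_def flexible_edges_def)
    moreover have "a_end e = u" "b_end e = v"
      using 2 ends_eqD by blast+
    ultimately show ?thesis
      using 2(2,4) that(2)[of e u v] by simp
  next
    case (3 e u v)
    then have "e \<in> edges G" "e \<notin> flexible_edges G b" "e \<notin> M"
      using M by (auto simp: forbidden_edges_def allowed_edges_def flexible_edges_def)
    moreover have "a_end e = u" "b_end e = v"
      using 3 ends_eqD by blast+
    ultimately show ?thesis
      using 3(2,4) that(2)[of e v u] by simp
  qed
qed

section \<open>Chains of components and antisymmetry\<close>

definition comp_step :: "('v, 'e) graph \<Rightarrow> ('v, 'e) graph \<Rightarrow> bool" where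
  "comp_step C D \<longleftrightarrow> C \<in> flexible_components G b \<and> D \<in> flexible_components G b \<and>
     flex_step G b A B C D"

text \<open>The assumption on \<open>C1\<close> covers the trivial chain: the closure is reflexive
  at every graph, but \<open>flex_le\<close> admits only components.\<close>

lemma flex_le_iff:
  assumes "C1 \<in> flexible_components G b"
  shows "flex_le G b A B C1 C2 \<longleftrightarrow> comp_step\<^sup>*\<^sup>* C1 C2"
proof
  assume "flex_le G b A B C1 C2"
  then obtain Ds where "Ds \<noteq> []" "set Ds \<subseteq> flexible_components G b" "hd Ds = C1" "last Ds = C2"
    "\<forall>i. Suc i < length Ds \<longrightarrow> flex_step G b A B (Ds ! i) (Ds ! Suc i)"
    unfolding flex_le_def by blast
  then show "comp_step\<^sup>*\<^sup>* C1 C2"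
  proof (induction Ds arbitrary: C1 rule: list_nonempty_induct)
    case (cons D Ds)
    have "comp_step\<^sup>*\<^sup>* (hd Ds) C2"
    proof (rule cons.IH)
      show "\<forall>i. Suc i < length Ds \<longrightarrow> flex_step G b A B (Ds ! i) (Ds ! Suc i)"
        using cons.prems(4) by (metis Suc_less_eq length_Cons nth_Cons_Suc)
    qed (use cons in auto)
    moreover have "flex_step G b A B D (hd Ds)"
      using cons.prems(4)[rule_format, of 0] cons.hyps by (cases Ds) auto
    then have "comp_step C1 (hd Ds)"
      using cons by (auto simp: comp_step_def)
    ultimately show ?case
      by (rule converse_rtranclp_into_rtranclp[rotated])
  qed auto
next
  assume "comp_step\<^sup>*\<^sup>* C1 C2"
  then show "flex_le G b A B C1 C2"
    using assms
  proof (induction rule: converse_rtranclp_induct)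
    case base
    then show ?case
      unfolding flex_le_def by (intro exI[of _ "[C2]"]) auto
  next
    case (step C D)
    then have "flex_le G b A B D C2"
      by (simp add: comp_step_def)
    then obtain Ds where Ds: "Ds \<noteq> []" "set Ds \<subseteq> flexible_components G b" "hd Ds = D"
      "last Ds = C2" "\<forall>i. Suc i < length Ds \<longrightarrow> flex_step G b A B (Ds ! i) (Ds ! Suc i)"
      unfolding flex_le_def by blast
    have "flex_step G b A B ((C # Ds) ! i) ((C # Ds) ! Suc i)" if "Suc i < length (C # Ds)" for i
      using that Ds step.hyps by (cases i) (auto simp: comp_step_def hd_conv_nth)
    then show ?case
      using Ds step unfolding flex_le_def by (intro exI[of _ "C # Ds"]) auto
  qed
qed

lemma comp_steps_reach:
  assumes M: "maximum_b_matching G b M" and "comp_step\<^sup>*\<^sup>* C D" "C \<in> flexible_components G b"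
    and "u \<in> verts C" "v \<in> verts D"
  shows "(Vertex u, Vertex v) \<in> reach M"
  using assms(2,5)
proof (induction arbitrary: v rule: rtranclp_induct)
  case base
  then show ?case
    using flexible_component_reach[OF M] assms by blast
next
  case (step D E)
  then have DE: "E \<in> flexible_components G b" "flex_step G b A B D E"
    by (auto simp: comp_step_def)
  from M DE(2) show ?case
  proof (cases rule: flex_step_cases)
    case 1
    then show ?thesis using step by blast
  next
    case (2 e x y)
    have "(Vertex u, Vertex x) \<in> reach M"
      using step.IH 2 by blast
    moreover have "(Vertex x, Vertex y) \<in> reach M"
      using reach_edge[of e M] 2 by metis
    moreover have "(Vertex y, Vertex v) \<in> reach M"
      using flexible_component_reach[OF M DE(1)] 2 step.prems by blast
    ultimately show ?thesis
      by (metis reach_trans)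
  qed
qed

text \<open>If the last step from \<open>D\<close> to \<open>E\<close> used an arc, the way back
  from \<open>E\<close> to \<open>D\<close> through \<open>C\<close> would lead from its head to its
  tail and make its edge flexible.\<close>

lemma comp_steps_antisym:
  assumes "comp_step\<^sup>*\<^sup>* C D" "comp_step\<^sup>*\<^sup>* D C" "C \<in> flexible_components G b"
  shows "C = D"
proof -
  obtain M where M: "maximum_b_matching G b M"
    using ex_maximum_b_matching by blast
  from assms(1,2) show ?thesis
  proof (induction rule: rtranclp_induct)
    case (step D E)
    from step have DE: "E \<in> flexible_components G b" "flex_step G b A B D E"
      by (auto simp: comp_step_def)
    have ED: "comp_step\<^sup>*\<^sup>* E D"
      using step by (meson rtranclp_trans)
    from M DE(2) show ?case
    proof (cases rule: flex_step_cases)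
      case 1
      then show ?thesis using step by blast
    next
      case (2 e x y)
      then have "(head M (Edge e), tail M (Edge e)) \<in> reach M"
        using comp_steps_reach[OF M ED DE(1)] by metis
      then show ?thesis
        using flexible_if_head_reaches_tail[OF M] 2 by blast
    qed
  qed simp
qed

lemma partial_order_comp_steps:
  "partial_order_on (flexible_components G b)
     {(C, D). C \<in> flexible_components G b \<and> D \<in> flexible_components G b \<and> comp_step\<^sup>*\<^sup>* C D}"
  by (auto simp: partial_order_on_def preorder_on_def
      intro!: refl_onI transI antisymI comp_steps_antisym intro: rtranclp_trans)

end

theorem mainTheorem4:
  fixes G :: "('v, 'e) graph" and A B :: "'v set" and b :: "'v \<Rightarrow> nat"
  assumes "finite_graph G" and "bipartite G A B"
  shows "partial_order_on (flexible_components G b)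
           {(C1, C2). C1 \<in> flexible_components G b \<and> C2 \<in> flexible_components G b \<and>
                      flex_le G b A B C1 C2}"
proof -
  interpret bipartite_b_graph G A B b
    using assms by unfold_locales
  have "{(C1, C2). C1 \<in> flexible_components G b \<and> C2 \<in> flexible_components G b \<and>
          flex_le G b A B C1 C2}
      = {(C, D). C \<in> flexible_components G b \<and> D \<in> flexible_components G b \<and>
          comp_step\<^sup>*\<^sup>* C D}"
    using flex_le_iff by auto
  then show ?thesis
    using partial_order_comp_steps by simp
qed

end
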